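(* Let $(R,<)$ be an ordered commutative ring with $1$ whose order $\leq$ is a total ordering, such that $R$ is dense and shrinkable. Let $r\in R$ be such that $1-r$ is invertible in $R$ and $(r^n)$ converges to zero in $R$. Let $(G,+)$ be a Cauchy complete $R$-normed abelian group and $(x_n)_{n=0}^{+\infty}$ a sequence in $G$ such that $\Vert x_{n+1}\Vert\leq r\Vert x_n\Vert$ for all $n$. Then $\sum_{n=0}^{+\infty}x_n$ is convergent in $G$.
   Context: $(R,<)$ with $\leq$ total is an ordered ring if $R$ is a ring, $a<b$ implies $a+c<b+c$, and $a<b$, $0<c$ imply $ac<bc$ and $ca<cb$, for all $a,b,c\in R$ (similarly for $\leq$, with $c\geq 0$). $R$ is dense if for any $\alpha>0$ in $R$ there are $\beta>0$ and $\gamma>0$ in $R$ with $\beta+\gamma<\alpha$. $R$ is shrinkable if for any given $\alpha>0$ and $M>0$ in $R$ there are $\alpha_l>0$ and $\alpha_r>0$ in $R$ with $M\alpha_r<\alpha$ and $\alpha_l M<\alpha$. With $|x|=\max\{x,-x\}$, a sequence $(a_n)$ in $R$ converges to $a\in R$ if for every $\epsilon>0$ in $R$ there is $N$ such that $n\geq N$ implies $|a_n-a|<\epsilon$. A group $(G,+)$ is $R$-normed if it is equipped with a function $\Vert\cdot\Vert:G\to R$ such that for all $g,h\in G$: $\Vert g\Vert\geq 0$, and $\Vert g\Vert=0$ if and only if $g=0$; and $\Vert g-h\Vert\leq\Vert g\Vert+\Vert h\Vert$. A sequence $(g_n)$ in $G$ converges to $g\in G$ if for every $\epsilon>0$ in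 $R$ there is $N$ such that $n\geq N$ implies $\Vert g_n-g\Vert<\epsilon$; it is Cauchy if for every $\epsilon>0$ in $R$ there is $N$ such that $m,n\geq N$ implies $\Vert g_n-g_m\Vert<\epsilon$. $G$ is Cauchy complete if every Cauchy sequence in $G$ converges in $G$. A series converges if its sequence of partial sums converges. *)

theory Defs
  imports Main
begin

text \<open>
  A totally ordered ring with strictly monotone multiplication is a type of class
  \<^class>\<open>linordered_ring_strict\<close>, which is associative but assumes neither commutativity nor a unit.
  Its absolute value satisfies |x| = max x (-x). The sort
  {linordered_ring_strict, comm_monoid_mult} adds commutativity and 1 without
  assuming 0 to be different from 1, so the zero ring is not excluded, as it would be by
  \<^class>\<open>linordered_idom\<close>.
\<close>

definition dense_ring :: "'r::linordered_ring_strict itself \<Rightarrow> bool" where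
  "dense_ring _ \<longleftrightarrow> (\<forall>\<alpha>::'r. \<alpha> > 0 \<longrightarrow> (\<exists>\<beta>>0. \<exists>\<gamma>>0. \<beta> + \<gamma> < \<alpha>))"

definition shrinkable_ring :: "'r::linordered_ring_strict itself \<Rightarrow> bool" where
  "shrinkable_ring _ \<longleftrightarrow>
     (\<forall>\<alpha>::'r. \<forall>M::'r. \<alpha> > 0 \<longrightarrow> M > 0 \<longrightarrow>
        (\<exists>\<alpha>l>0. \<exists>\<alpha>r>0. M * \<alpha>r < \<alpha> \<and> \<alpha>l * M < \<alpha>))"

definition ring_norm :: "('g::group_add \<Rightarrow> 'r::linordered_ring_strict) \<Rightarrow> bool" where
  "ring_norm nrm \<longleftrightarrow>
     (\<forall>g. nrm g \<ge> 0) \<and> (\<forall>g. nrm g = 0 \<longleftrightarrow> g = 0) \<and>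
     (\<forall>g h. nrm (g - h) \<le> nrm g + nrm h)"

text \<open>Convergence in the ring itself is the instance \<open>converges_to abs\<close>.\<close>

definition converges_to ::
    "('g::group_add \<Rightarrow> 'r::linordered_ring_strict) \<Rightarrow> (nat \<Rightarrow> 'g) \<Rightarrow> 'g \<Rightarrow> bool" where
  "converges_to nrm s l \<longleftrightarrow> (\<forall>\<epsilon>>0. \<exists>N. \<forall>n\<ge>N. nrm (s n - l) < \<epsilon>)"

definition cauchy_seq ::
    "('g::group_add \<Rightarrow> 'r::linordered_ring_strict) \<Rightarrow> (nat \<Rightarrow> 'g) \<Rightarrow> bool" where
  "cauchy_seq nrm s \<longleftrightarrow> (\<forall>\<epsilon>>0. \<exists>N. \<forall>m\<ge>N. \<forall>n\<ge>N. nrm (s n - s m) < \<epsilon>)"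

definition cauchy_complete :: "('g::group_add \<Rightarrow> 'r::linordered_ring_strict) \<Rightarrow> bool" where
  "cauchy_complete nrm \<longleftrightarrow> (\<forall>s. cauchy_seq nrm s \<longrightarrow> (\<exists>l. converges_to nrm s l))"

definition series_converges ::
    "('g::ab_group_add \<Rightarrow> 'r::linordered_ring_strict) \<Rightarrow> (nat \<Rightarrow> 'g) \<Rightarrow> bool" where
  "series_converges nrm x \<longleftrightarrow> (\<exists>l. converges_to nrm (\<lambda>n. \<Sum>k\<le>n. x k) l)"

end

theory Submission imports Defs begin

text \<open>
  The hypothesis \<open>\<parallel>x (n+1)\<parallel> \<le> r \<parallel>x n\<parallel>\<close> says \<open>(1 - r) \<parallel>x n\<parallel> \<le> \<parallel>x n\<parallel> - \<parallel>x (n+1)\<parallel>\<close>. The right-hand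
  side telescopes, so \<open>1 - r\<close> times any block of norms starting at index \<open>m\<close> is at most \<open>\<parallel>x m\<parallel>\<close>
  (\<open>mult_sum_le_telescope\<close>). This replaces the formula for the geometric sum. If
  \<open>r\<^sup>n\<close> tends to zero and the ring is nontrivial, then \<open>r < 1\<close>, and the factor \<open>1 - r\<close> can be
  cancelled from \<open>(1 - r) S < (1 - r) \<epsilon>\<close>; in the zero ring there is no \<open>\<epsilon> > 0\<close> to consider.
  The partial sums are therefore Cauchy as soon as \<open>\<parallel>x m\<parallel>\<close> tends to zero.

  That follows from \<open>\<parallel>x m\<parallel> \<le> \<bar>r\<^sup>m\<bar> \<parallel>x 0\<parallel>\<close>. In a general ordered ring a null sequence times a
  constant need not be null: in the real polynomials in \<open>X\<close>, ordered so that \<open>X\<close> exceeds every real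
  number, \<open>2\<close> to the power \<open>-n\<close> is null, but its product with \<open>X\<close> is not. Shrinkability
  excludes this (\<open>eventually_mult_less\<close>).
\<close>

lemma ring_norm_minus:
  assumes "ring_norm nrm"
  shows "nrm (- g) = nrm g"
proof -
  have le: "nrm (- h) \<le> nrm h" for h
  proof -
    have "nrm (0 - h) \<le> nrm 0 + nrm h" "nrm 0 = 0"
      using assms unfolding ring_norm_def by blast+
    then show ?thesis by simp
  qed
  from le[of g] le[of "- g"] show ?thesis by simp
qed

lemma ring_norm_sum_le:
  fixes nrm :: "'g::ab_group_add \<Rightarrow> 'r::linordered_ring_strict"
  assumes "ring_norm nrm"
  shows "nrm (sum x A) \<le> (\<Sum>k\<in>A. nrm (x k))"
proof -
  have add: "nrm (g + h) \<le> nrm g + nrm h" for g h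
  proof -
    have "nrm (g - - h) \<le> nrm g + nrm (- h)"
      using assms unfolding ring_norm_def by blast
    then show ?thesis using ring_norm_minus[OF assms] by simp
  qed
  have zero: "nrm 0 = 0" using assms unfolding ring_norm_def by blast
  show ?thesis
  proof (induction A rule: infinite_finite_induct)
    case (insert a A)
    have "nrm (x a + sum x A) \<le> nrm (x a) + nrm (sum x A)" by (rule add)
    also have "\<dots> \<le> nrm (x a) + (\<Sum>k\<in>A. nrm (x k))"
      using insert.IH by (rule add_left_mono)
    finally show ?case using insert.hyps by simp
  qed (simp_all add: zero)
qed

lemma one_pos_if_pos:
  fixes \<epsilon> :: "'r::{linordered_ring_strict, comm_monoid_mult}"
  assumes "\<epsilon> > 0"
  shows "(1::'r) > 0"
proof -
  have "(1::'r) \<noteq> 0"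
  proof
    assume "(1::'r) = 0"
    then have "1 * \<epsilon> = 0 * \<epsilon>" by simp
    with assms show False by simp
  qed
  moreover have "(1::'r) \<ge> 0" using zero_le_square[of "1::'r"] by simp
  ultimately show ?thesis by simp
qed

text \<open>
  If \<open>r \<ge> 1\<close>, then all powers of \<open>r\<close> are at least \<open>1\<close>, so \<open>1\<close> itself is an \<open>\<epsilon>\<close> that they
  never get below. The hypothesis on \<open>\<epsilon>\<close> only says that the ring is nontrivial.
\<close>

lemma less_one_if_powers_null:
  fixes r \<epsilon> :: "'r::{linordered_ring_strict, comm_monoid_mult}"
  assumes "converges_to abs (\<lambda>n. r ^ n) 0" and "\<epsilon> > 0"
  shows "r < 1"
proof (rule ccontr)
  assume "\<not> r < 1"
  then have r: "1 \<le> r" by simp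
  have one: "(1::'r) > 0" using assms(2) by (rule one_pos_if_pos)
  have ge: "1 \<le> r ^ n" for n
  proof (induction n)
    case (Suc n)
    have "1 * 1 \<le> r * r ^ n"
      using r Suc one by (intro mult_mono) auto
    then show ?case by simp
  qed simp
  from assms(1) one obtain N where "\<bar>r ^ N - 0\<bar> < 1"
    unfolding converges_to_def by blast
  then have "r ^ N < 1" using abs_ge_self[of "r ^ N"] by simp
  with ge[of N] show False by simp
qed

lemma eventually_mult_less:
  fixes s :: "nat \<Rightarrow> 'r::{linordered_ring_strict, comm_monoid_mult}"
  assumes "shrinkable_ring TYPE('r)" and "converges_to abs s 0" and "C \<ge> 0" and "\<epsilon> > 0"
  shows "\<exists>N. \<forall>n\<ge>N. \<bar>s n\<bar> * C < \<epsilon>"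
proof -
  \<comment> \<open>Shrinkability needs a positive multiplier, but \<open>C\<close> may vanish.\<close>
  have "C + 1 > 0" using assms(3) one_pos_if_pos[OF assms(4)] by (rule add_nonneg_pos)
  with assms(1,4) obtain \<delta> where \<delta>: "\<delta> > 0" "\<delta> * (C + 1) < \<epsilon>"
    unfolding shrinkable_ring_def by meson
  from assms(2) \<delta>(1) obtain N where N: "\<And>n. n \<ge> N \<Longrightarrow> \<bar>s n - 0\<bar> < \<delta>"
    unfolding converges_to_def by blast
  have "\<bar>s n\<bar> * C < \<epsilon>" if "n \<ge> N" for n
  proof -
    have "\<bar>s n\<bar> * C \<le> \<delta> * (C + 1)"
      using N[OF that] \<delta>(1) assms(3) one_pos_if_pos[OF assms(4)]
      by (intro mult_mono) auto
    with \<delta>(2) show ?thesis by simp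
  qed
  then show ?thesis by blast
qed

lemma abs_mult_linordered_ring_strict:
  fixes a b :: "'r::linordered_ring_strict"
  shows "\<bar>a * b\<bar> = \<bar>a\<bar> * \<bar>b\<bar>"
  by (cases "a \<ge> 0"; cases "b \<ge> 0")
     (auto simp: abs_if mult_less_0_iff not_le not_less mult_le_0_iff zero_le_mult_iff)

text \<open>
  The absolute value makes the induction work for every sign of \<open>r\<close>: multiplying the induction
  hypothesis by \<open>r\<close> would require \<open>r \<ge> 0\<close>.
\<close>

lemma le_abs_power_mult:
  fixes r :: "'r::{linordered_ring_strict, comm_monoid_mult}"
  assumes "\<And>n. a (Suc n) \<le> r * a n" and "\<And>n. a n \<ge> 0"
  shows "a n \<le> \<bar>r ^ n\<bar> * a 0"
proof (induction n)
  case 0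
  have "1 * a 0 \<le> \<bar>1\<bar> * a 0"
    using assms(2) by (intro mult_right_mono abs_ge_self)
  then show ?case by simp
next
  case (Suc n)
  have "a (Suc n) \<le> r * a n" by (rule assms(1))
  also have "\<dots> \<le> \<bar>r\<bar> * a n" using assms(2) by (intro mult_right_mono abs_ge_self)
  also have "\<dots> \<le> \<bar>r\<bar> * (\<bar>r ^ n\<bar> * a 0)" using Suc by (intro mult_left_mono) auto
  also have "\<dots> = \<bar>r ^ Suc n\<bar> * a 0" by (simp add: abs_mult_linordered_ring_strict mult.assoc)
  finally show ?case .
qed

lemma mult_sum_le_telescope:
  fixes r :: "'r::{linordered_ring_strict, comm_monoid_mult}"
  assumes "\<And>n. a (Suc n) \<le> r * a n" and "m \<le> n"
  shows "(1 - r) * (\<Sum>k=m..<n. a k) \<le> a m - a n"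
  using assms(2)
proof (induction n rule: dec_induct)
  case (step n)
  have "(1 - r) * a n \<le> a n - a (Suc n)"
    using assms(1)[of n] by (simp add: left_diff_distrib)
  from add_mono[OF step.IH this] show ?case
    using step.hyps by (simp add: distrib_left)
qed simp

theorem theorem4p7:
  fixes r :: "'r::{linordered_ring_strict, comm_monoid_mult}"
    and nrm :: "'g::ab_group_add \<Rightarrow> 'r"
    and x :: "nat \<Rightarrow> 'g"
  assumes "dense_ring TYPE('r)"
    and "shrinkable_ring TYPE('r)"
    and "(1 - r) dvd 1"
    and "converges_to abs (\<lambda>n. r ^ n) 0"
    and "ring_norm nrm"
    and "cauchy_complete nrm"
    and "\<And>n. nrm (x (Suc n)) \<le> r * nrm (x n)"
  shows "series_converges nrm x"
proof -
  let ?S = "\<lambda>n. \<Sum>k\<le>n. x k"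
  have nonneg: "nrm g \<ge> 0" for g using assms(5) unfolding ring_norm_def by blast
  have "\<exists>N. \<forall>m\<ge>N. \<forall>n\<ge>N. nrm (?S n - ?S m) < \<epsilon>" if "\<epsilon> > 0" for \<epsilon> :: 'r
  proof -
    have pos: "1 - r > 0" using less_one_if_powers_null[OF assms(4) that] by simp
    then have "(1 - r) * \<epsilon> > 0" using that by simp
    from eventually_mult_less[OF assms(2,4) nonneg this] obtain N
      where N: "\<And>n. n \<ge> N \<Longrightarrow> \<bar>r ^ n\<bar> * nrm (x 0) < (1 - r) * \<epsilon>" by blast
    have le: "nrm (?S n - ?S m) < \<epsilon>" if "N \<le> m" "m \<le> n" for m n
    proof -
      let ?T = "\<Sum>k=Suc m..<Suc n. nrm (x k)"
      have "?S n - ?S m = (\<Sum>k=Suc m..<Suc n. x k)"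
        using that(2) by (induction n rule: dec_induct) (simp_all add: algebra_simps)
      then have "nrm (?S n - ?S m) \<le> ?T"
        by (simp only: ring_norm_sum_le[OF assms(5)])
      also have "?T < \<epsilon>"
      proof -
        have "(1 - r) * ?T \<le> nrm (x (Suc m)) - nrm (x (Suc n))"
          using that(2) by (intro mult_sum_le_telescope[of "\<lambda>k. nrm (x k)"] assms(7)) simp
        also have "\<dots> \<le> nrm (x (Suc m))" using nonneg by simp
        also have "\<dots> \<le> \<bar>r ^ Suc m\<bar> * nrm (x 0)"
          by (rule le_abs_power_mult[of "\<lambda>k. nrm (x k)", OF assms(7) nonneg])
        also have "\<dots> < (1 - r) * \<epsilon>" using that(1) by (intro N) simp
        finally show ?thesis using pos mult_less_cancel_left_pos by blast
      qed
      finally show ?thesis .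
    qed
    have "nrm (?S n - ?S m) < \<epsilon>" if "m \<ge> N" "n \<ge> N" for m n
    proof (cases "m \<le> n")
      case True
      with that(1) show ?thesis by (rule le)
    next
      case False
      then have "nrm (?S m - ?S n) < \<epsilon>" using that(2) by (intro le) auto
      with ring_norm_minus[OF assms(5), of "?S m - ?S n"] show ?thesis by simp
    qed
    then show ?thesis by blast
  qed
  then have "cauchy_seq nrm ?S" unfolding cauchy_seq_def by blast
  with assms(6) show ?thesis unfolding cauchy_complete_def series_converges_def by blast
qed

end
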